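(* Let $p,q\in\mathbb{C}$, $h\in\mathbb{C}\setminus\{0\}$ and let $n\geq 1$ be an integer. In the $(p,q)$-deformed Weyl algebra $A_{0;h|p,q}$ one has $$(YX)^n=\sum_{\ell=0}^{n}\mathscr{R}_{h;p,q}[J_n,n-\ell]\;Y^{\ell}Z_p^{n-\ell}X^{\ell}.$$ Consequently $\mathfrak{S}_{0;h}(n,\ell|p,q)=\mathscr{R}_{h;p,q}[J_n,n-\ell]$ for $0\le\ell\le n$, and in particular the $(p,q)$-deformed Stirling numbers of the second kind satisfy $$S_{p,q}(n,\ell)=\mathscr{R}_{1;p,q}[J_n,n-\ell]\qquad(0\le\ell\le n).$$
   Context: The algebra $A_{0;h|p,q}$ is the complex unital algebra generated by $X,Y,Z_p$ subject to $XY-qYX=hZ_p$, $Z_pY=pYZ_p$, $XZ_p=pZ_pX$, with the convention $Z_1=I$ (i.e. for $p=1$ the element $Z_p$ is the identity). The numbers $\mathfrak{S}_{0;h}(n,k|p,q)$ are defined as the normal ordering coefficients of $(YX)^n$ in $A_{0;h|p,q}$, i.e. by $(YX)^n=\sum_{k=0}^n\mathfrak{S}_{0;h}(n,k|p,q)\,Y^kZ_p^{n-k}X^k$. Twin-basic numbers: $[k]_{p,q}=\frac{p^k-q^k}{p-q}=p^{k-1}+p^{k-2}q+\cdots+q^{k-1}$, $[0]_{p,q}=0$. The numbers $S_{p,q}(n,k)$ are determined by $S_{p,q}(0,0)=1$, $S_{p,q}(n,k)=0$ if $k<0$ or $k>n$, and $S_{p,q}(n,k)=p^{n-k}q^{k-1}S_{p,q}(n-1,k-1)+[k]_{p,q}S_{p,q}(n-1,k)$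 for $n\ge1$, $0\le k\le n$ (a term containing a vanishing $S_{p,q}$ is read as $0$); they coincide with $\mathfrak{S}_{0;1}(n,k|p,q)$. A Ferrers board is a top-justified arrangement of columns of boxes whose heights weakly decrease from left to right. The staircase board $J_n$ is the Ferrers board with columns of heights $n-1,n-2,\dots,2,1$ from left to right. For a Ferrers board $B$, let $\mathcal{R}(B,k)$ be the set of placements of $k$ non-attacking rooks on $B$ (no two in the same row or column). Given $\phi\in\mathcal{R}(B,k)$, the boxes of $B$ are divided into: rook boxes (occupied by a rook); $p$-boxes, i.e. non-rook boxes which either lie above a rook (in its column) and not to the left of another rook (in its row), or lie to the left of a rook (in its row) and not in the column of another rook; cancelled boxes, i.e. non-rook boxes lying above or to the left of a rook which are not $p$-boxes; and $q$-boxes, all remaining boxes. The weight is $\omega_{p,q}(B;\phi)=h^kp^{\#p\text{-boxes}}q^{\#q\text{-boxes}}$, and $\mathscr{R}_{h;p,q}[B,k]=\sum_{\phi\in\mathcal{R}(B,k)}\omega_{p,q}(B;\phi)$ (equal to $0$ if there are no such placements). *)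

theory Defs
  imports
    Complex_Main
    "HOL-Library.Poly_Mapping"
    "HOL-Algebra.QuotRing"
    "HOL-Algebra.Algebraic_Closure_Type"
begin

datatype generator = GX | GY | GZ

text \<open>Words form the free monoid, written additively (and not commutative) so that
  finitely supported functions on words carry the convolution product.\<close>

datatype word = Word (letters: "generator list")

instantiation word :: monoid_add
begin

definition zero_word :: word where "0 = Word []"

definition plus_word :: "word \<Rightarrow> word \<Rightarrow> word" where
  "u + v = Word (letters u @ letters v)"

instance
  by standard (simp_all add: zero_word_def plus_word_def)

end

type_synonym free_algebra = "word \<Rightarrow>\<^sub>0 complex"

definition gen :: "generator \<Rightarrow> free_algebra" where
  "gen g = Poly_Mapping.single (Word [g]) 1"

definition scal :: "complex \<Rightarrow> free_algebra" where
  "scal c = Poly_Mapping.single 0 c"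

abbreviation free_ring :: "free_algebra ring" where
  "free_ring \<equiv> ring_of_type_algebra"

text \<open>The last component is the convention that the third generator is the identity
  when \<open>p = 1\<close>.\<close>

definition weyl_relators :: "complex \<Rightarrow> complex \<Rightarrow> complex \<Rightarrow> free_algebra set" where
  "weyl_relators h p q =
     {gen GX * gen GY - scal q * gen GY * gen GX - scal h * gen GZ,
      gen GZ * gen GY - scal p * gen GY * gen GZ,
      gen GX * gen GZ - scal p * gen GZ * gen GX}
     \<union> (if p = 1 then {gen GZ - 1} else {})"

text \<open>Ideals in \<^theory>\<open>HOL-Algebra.Ideal\<close> are two-sided.\<close>

definition weyl_ideal :: "complex \<Rightarrow> complex \<Rightarrow> complex \<Rightarrow> free_algebra set" where
  "weyl_ideal h p q = Idl\<^bsub>free_ring\<^esub> (weyl_relators h p q)"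

definition weyl_algebra :: "complex \<Rightarrow> complex \<Rightarrow> complex \<Rightarrow> free_algebra set ring" where
  "weyl_algebra h p q = free_ring Quot (weyl_ideal h p q)"

definition weyl_class :: "complex \<Rightarrow> complex \<Rightarrow> complex \<Rightarrow> free_algebra \<Rightarrow> free_algebra set" where
  "weyl_class h p q u = weyl_ideal h p q +>\<^bsub>free_ring\<^esub> u"

definition weyl_X :: "complex \<Rightarrow> complex \<Rightarrow> complex \<Rightarrow> free_algebra set" where
  "weyl_X h p q = weyl_class h p q (gen GX)"

definition weyl_Y :: "complex \<Rightarrow> complex \<Rightarrow> complex \<Rightarrow> free_algebra set" where
  "weyl_Y h p q = weyl_class h p q (gen GY)"

definition weyl_Z :: "complex \<Rightarrow> complex \<Rightarrow> complex \<Rightarrow> free_algebra set" where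
  "weyl_Z h p q = weyl_class h p q (gen GZ)"

text \<open>The image of the scalar \<open>c\<close>; multiplication by it is the complex scalar
  multiplication of the algebra.\<close>

definition weyl_scal :: "complex \<Rightarrow> complex \<Rightarrow> complex \<Rightarrow> complex \<Rightarrow> free_algebra set" where
  "weyl_scal h p q c = weyl_class h p q (scal c)"

lemma ring_free_ring: "ring free_ring"
proof -
  have "\<exists>y. x + y = 0" for x :: free_algebra
    using add.right_inverse by blast
  thus ?thesis
    unfolding ring_of_type_algebra_def using add.right_inverse
    by unfold_locales (auto simp: algebra_simps Units_def)
qed

lemma ideal_weyl_ideal: "ideal (weyl_ideal h p q) free_ring"
  unfolding weyl_ideal_def
  by (rule ring.genideal_ideal[OF ring_free_ring]) (simp add: ring_of_type_algebra_def)

lemma ring_weyl_algebra: "ring (weyl_algebra h p q)"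
  unfolding weyl_algebra_def by (rule ideal.quotient_is_ring[OF ideal_weyl_ideal])

lemma weyl_class_hom: "weyl_class h p q \<in> ring_hom free_ring (weyl_algebra h p q)"
proof -
  have "weyl_class h p q = (+>\<^bsub>free_ring\<^esub>) (weyl_ideal h p q)"
    by (rule ext) (simp add: weyl_class_def)
  then show ?thesis
    using ideal.rcos_ring_hom[OF ideal_weyl_ideal] by (simp add: weyl_algebra_def)
qed

text \<open>Extending the coefficient sequence by zero beyond \<open>n\<close> makes the description definite.\<close>

definition normal_ordering_coeff ::
    "complex \<Rightarrow> complex \<Rightarrow> complex \<Rightarrow> nat \<Rightarrow> nat \<Rightarrow> complex" where
  "normal_ordering_coeff h p q n =
     (let A = weyl_algebra h p q; x = weyl_X h p q; y = weyl_Y h p q; z = weyl_Z h p q in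
      (THE c. (\<forall>k>n. c k = 0) \<and>
         (y \<otimes>\<^bsub>A\<^esub> x) [^]\<^bsub>A\<^esub> n =
         (\<Oplus>\<^bsub>A\<^esub>k\<in>{0..n}. weyl_scal h p q (c k) \<otimes>\<^bsub>A\<^esub>
            (y [^]\<^bsub>A\<^esub> k \<otimes>\<^bsub>A\<^esub> z [^]\<^bsub>A\<^esub> (n - k) \<otimes>\<^bsub>A\<^esub> x [^]\<^bsub>A\<^esub> k))))"

text \<open>The form of the twin-basic number without division also covers \<open>p = q\<close>.\<close>

definition twin_basic :: "complex \<Rightarrow> complex \<Rightarrow> nat \<Rightarrow> complex" where
  "twin_basic p q k = (\<Sum>i<k. p ^ (k - 1 - i) * q ^ i)"

lemma twin_basic_eq_quotient:
  assumes "p \<noteq> q"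
  shows "twin_basic p q k = (p ^ k - q ^ k) / (p - q)"
proof -
  have "p ^ k - q ^ k = (p - q) * twin_basic p q k"
    using power_diff_sumr2[of q k p]
    by (simp add: twin_basic_def algebra_simps)
  then show ?thesis using assms by simp
qed

text \<open>In the last equation the truncated difference \<open>n - k\<close> matters only for \<open>k > n\<close>,
  where the factor \<open>stirling2 p q n k\<close> vanishes.\<close>

fun stirling2 :: "complex \<Rightarrow> complex \<Rightarrow> nat \<Rightarrow> nat \<Rightarrow> complex" where
  "stirling2 p q 0 0 = 1"
| "stirling2 p q 0 (Suc k) = 0"
| "stirling2 p q (Suc n) 0 = twin_basic p q 0 * stirling2 p q n 0"
| "stirling2 p q (Suc n) (Suc k) =
     p ^ (n - k) * q ^ k * stirling2 p q n k + twin_basic p q (Suc k) * stirling2 p q n (Suc k)"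

lemma stirling2_eq_0: "n < k \<Longrightarrow> stirling2 p q n k = 0"
  by (induction p q n k rule: stirling2.induct) auto

text \<open>A box is a pair (row, column), counted from \<open>0\<close>, from the top and from the left.
  The list \<open>hs\<close> of column heights is meant to be weakly decreasing.\<close>

definition ferrers_board :: "nat list \<Rightarrow> (nat \<times> nat) set" where
  "ferrers_board hs = {(i, j). j < length hs \<and> i < hs ! j}"

definition staircase_board :: "nat \<Rightarrow> (nat \<times> nat) set" where
  "staircase_board n = ferrers_board (rev [1..<n])"

definition rook_placements :: "(nat \<times> nat) set \<Rightarrow> nat \<Rightarrow> (nat \<times> nat) set set" where
  "rook_placements B k =
     {\<phi>. \<phi> \<subseteq> B \<and> finite \<phi> \<and> card \<phi> = k \<and>
        (\<forall>(i, j)\<in>\<phi>. \<forall>(i', j')\<in>\<phi>. i = i' \<or> j = j' \<longrightarrow> (i, j) = (i', j'))}"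

definition above_rook :: "(nat \<times> nat) set \<Rightarrow> nat \<times> nat \<Rightarrow> bool" where
  "above_rook \<phi> b \<longleftrightarrow> (\<exists>i>fst b. (i, snd b) \<in> \<phi>)"

definition left_of_rook :: "(nat \<times> nat) set \<Rightarrow> nat \<times> nat \<Rightarrow> bool" where
  "left_of_rook \<phi> b \<longleftrightarrow> (\<exists>j>snd b. (fst b, j) \<in> \<phi>)"

definition in_rook_column :: "(nat \<times> nat) set \<Rightarrow> nat \<times> nat \<Rightarrow> bool" where
  "in_rook_column \<phi> b \<longleftrightarrow> (\<exists>i. (i, snd b) \<in> \<phi>)"

text \<open>For a box without a rook, a rook in its column and a rook in its row are automatically
  different, so ``another rook'' needs no separate condition.\<close>

definition p_boxes :: "(nat \<times> nat) set \<Rightarrow> (nat \<times> nat) set \<Rightarrow> (nat \<times> nat) set" where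
  "p_boxes B \<phi> = {b \<in> B - \<phi>. above_rook \<phi> b \<and> \<not> left_of_rook \<phi> b \<or>
                            left_of_rook \<phi> b \<and> \<not> in_rook_column \<phi> b}"

definition cancelled_boxes :: "(nat \<times> nat) set \<Rightarrow> (nat \<times> nat) set \<Rightarrow> (nat \<times> nat) set" where
  "cancelled_boxes B \<phi> = {b \<in> B - \<phi>. above_rook \<phi> b \<or> left_of_rook \<phi> b} - p_boxes B \<phi>"

definition q_boxes :: "(nat \<times> nat) set \<Rightarrow> (nat \<times> nat) set \<Rightarrow> (nat \<times> nat) set" where
  "q_boxes B \<phi> = B - \<phi> - p_boxes B \<phi> - cancelled_boxes B \<phi>"

definition rook_weight ::
    "complex \<Rightarrow> complex \<Rightarrow> complex \<Rightarrow> (nat \<times> nat) set \<Rightarrow> (nat \<times> nat) set \<Rightarrow> complex" where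
  "rook_weight h p q B \<phi> =
     h ^ card \<phi> * p ^ card (p_boxes B \<phi>) * q ^ card (q_boxes B \<phi>)"

definition rook_number ::
    "complex \<Rightarrow> complex \<Rightarrow> complex \<Rightarrow> (nat \<times> nat) set \<Rightarrow> nat \<Rightarrow> complex" where
  "rook_number h p q B k = (\<Sum>\<phi>\<in>rook_placements B k. rook_weight h p q B \<phi>)"

end

theory Submission
  imports Defs
begin

text \<open>
  Removing the leftmost column of the staircase board gives a recurrence for its rook numbers:
  if the column has no rook, each of the \<open>k\<close> rooks to its right makes one \<open>p\<close>-box of it and
  the other boxes are \<open>q\<close>-boxes; a rook in the column makes the \<open>m\<close> rows free of other rooks
  contribute \<open>p\<^sup>i q\<^sup>j\<close> with \<open>i + j = m - 1\<close>, which sums to a twin-basic number, while all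
  boxes in the rows of other rooks are cancelled. Up to the power of \<open>h\<close> this is the recurrence
  of the deformed Stirling numbers, which also arises on multiplying a normally ordered
  monomial by \<open>Y X\<close> from the left. The normal ordering coefficients are unique because the
  monomials are linearly independent, as the left regular representation on the basis
  \<open>Y\<^sup>a Z\<^sup>b X\<^sup>c\<close> shows. This representation exists for all \<open>p\<close> and \<open>q\<close>.
\<close>

section \<open>Recurrences of the twin-basic numbers\<close>

lemma twin_basic_0 [simp]: "twin_basic p q 0 = 0"
  by (simp add: twin_basic_def)

lemma twin_basic_Suc: "twin_basic p q (Suc k) = p ^ k + q * twin_basic p q k"
  by (simp add: twin_basic_def sum.lessThan_Suc_shift sum_distrib_left algebra_simps del: sum.lessThan_Suc)

text \<open>Here the last summand is split off, in \<open>twin_basic_Suc\<close> the first. Moving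
  \<open>X\<close> past a power of \<open>Y\<close> produces this form, counting rows and checking
  the \<open>XY\<close> relation the other one.\<close>

lemma twin_basic_Suc': "twin_basic p q (Suc k) = q ^ k + p * twin_basic p q k"
proof -
  have "p ^ (k - i) = p * p ^ (k - 1 - i)" if "i < k" for i
    using that by (metis Suc_diff_Suc diff_Suc_eq_diff_pred power_Suc)
  then show ?thesis
    by (simp add: twin_basic_def sum_distrib_left mult.assoc)
qed

subsection \<open>Rook numbers of the staircase board\<close>

text \<open>An element with j members of \<open>A\<close> below it contributes p^j q^(m-1-j), where
  m is the size of \<open>A\<close>, and j takes each value below m once. In the induction a new
  maximum contributes a pure power of p and gives every other element one more factor q.\<close>

lemma sum_rank_weights:
  assumes "finite (A :: nat set)"
  shows "(\<Sum>r\<in>A. p ^ card {i\<in>A. i < r} * q ^ card {i\<in>A. r < i}) = twin_basic p q (card A)"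
  using assms
proof (induction A rule: finite_linorder_max_induct)
  case empty
  then show ?case by simp
next
  case (insert b A)
  then have "b \<notin> A" by auto
  have sets: "{i \<in> insert b A. i < b} = A" "{i \<in> insert b A. b < i} = {}"
    using insert by auto
  have "(\<Sum>r\<in>A. p ^ card {i \<in> insert b A. i < r} * q ^ card {i \<in> insert b A. r < i}) =
      (\<Sum>r\<in>A. q * (p ^ card {i\<in>A. i < r} * q ^ card {i\<in>A. r < i}))"
  proof (rule sum.cong)
    fix r assume "r \<in> A"
    then have "{i \<in> insert b A. i < r} = {i\<in>A. i < r}" "{i \<in> insert b A. r < i} = insert b {i\<in>A. r < i}"
      using insert by auto
    then show "p ^ card {i \<in> insert b A. i < r} * q ^ card {i \<in> insert b A. r < i} =
      q * (p ^ card {i\<in>A. i < r} * q ^ card {i\<in>A. r < i})"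
      using insert \<open>b \<notin> A\<close> by simp
  qed simp
  also have "\<dots> = q * twin_basic p q (card A)"
    by (simp only: insert.IH sum_distrib_left[symmetric])
  finally have "(\<Sum>r\<in>A. p ^ card {i \<in> insert b A. i < r} * q ^ card {i \<in> insert b A. r < i}) =
      q * twin_basic p q (card A)" .
  then show ?case
    unfolding sum.insert[OF insert.hyps(1) \<open>b \<notin> A\<close>] card_insert_disjoint[OF insert.hyps(1) \<open>b \<notin> A\<close>] sets
    by (simp add: twin_basic_Suc)
qed

section \<open>Boards with a column prepended on the left\<close>

definition shift_box :: "nat \<times> nat \<Rightarrow> nat \<times> nat" where
  "shift_box b = (fst b, Suc (snd b))"

definition add_column :: "nat \<Rightarrow> (nat \<times> nat) set \<Rightarrow> (nat \<times> nat) set" where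
  "add_column n B = {..<n} \<times> {0} \<union> shift_box ` B"

lemma inj_shift_box: "inj shift_box"
  by (auto simp: shift_box_def inj_def prod_eq_iff)

lemma shift_box_in_image [simp]:
  "(i, Suc j) \<in> shift_box ` B \<longleftrightarrow> (i, j) \<in> B" "(i, 0) \<notin> shift_box ` B"
  by (force simp: shift_box_def)+

lemma mem_add_column [simp]:
  "(i, Suc j) \<in> add_column n B \<longleftrightarrow> (i, j) \<in> B" "(i, 0) \<in> add_column n B \<longleftrightarrow> i < n"
  by (auto simp: add_column_def)

text \<open>Column j has height n - 1 - j. Stated with a sum, the condition avoids truncated
  subtraction and turns prepending a column into an index shift.\<close>

lemma staircase_board_eq: "staircase_board n = {(i, j). Suc (i + j) < n}"
  by (auto simp: staircase_board_def ferrers_board_def rev_nth)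

lemma staircase_board_Suc: "staircase_board (Suc n) = add_column n (staircase_board n)"
proof -
  have "(i, j) \<in> staircase_board (Suc n) \<longleftrightarrow> (i, j) \<in> add_column n (staircase_board n)" for i j
    by (cases j) (auto simp: staircase_board_eq)
  then show ?thesis by auto
qed

lemma rook_placements_eq:
  "rook_placements B k = {\<phi>. \<phi> \<subseteq> B \<and> finite \<phi> \<and> card \<phi> = k \<and> inj_on fst \<phi> \<and> inj_on snd \<phi>}"
  unfolding rook_placements_def inj_on_def by fastforce

lemma finite_rook_placements: "finite B \<Longrightarrow> finite (rook_placements B k)"
  by (rule finite_subset[of _ "Pow B"]) (auto simp: rook_placements_eq)

lemma box_set_eqI:
  fixes A B :: "(nat \<times> nat) set"
  assumes "\<And>i. (i, 0) \<in> A \<longleftrightarrow> (i, 0) \<in> B" "\<And>i j. (i, Suc j) \<in> A \<longleftrightarrow> (i, Suc j) \<in> B"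
  shows "A = B"
proof -
  have "(i, j) \<in> A \<longleftrightarrow> (i, j) \<in> B" for i j
    by (cases j) (use assms in auto)
  then show ?thesis by auto
qed

lemma q_boxes_eq:
  "q_boxes B \<phi> = {b \<in> B - \<phi>. \<not> above_rook \<phi> b \<and> \<not> left_of_rook \<phi> b}"
  by (auto simp: q_boxes_def cancelled_boxes_def p_boxes_def)

lemma ex_gt_0_iff: "(\<exists>j>0. P j) \<longleftrightarrow> (\<exists>j. P (Suc j))"
  by (metis gr0_conv_Suc)

lemma ex_gt_Suc_iff: "(\<exists>j>Suc m. P j) \<longleftrightarrow> (\<exists>j>m. P (Suc j))"
  by (metis Suc_less_eq2)

text \<open>The assumption says nothing about column 0 of \<psi>, so both kinds of placements, with
  and without a rook there, are covered.\<close>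

lemma rook_relations_shift:
  assumes "\<And>i j. (i, Suc j) \<in> \<psi> \<longleftrightarrow> (i, j) \<in> \<phi>"
  shows "left_of_rook \<psi> (i, Suc j) \<longleftrightarrow> left_of_rook \<phi> (i, j)"
    "left_of_rook \<psi> (i, 0) \<longleftrightarrow> i \<in> fst ` \<phi>"
    "above_rook \<psi> (i, Suc j) \<longleftrightarrow> above_rook \<phi> (i, j)"
    "in_rook_column \<psi> (i, Suc j) \<longleftrightarrow> in_rook_column \<phi> (i, j)"
  using assms
  by (auto simp: left_of_rook_def above_rook_def in_rook_column_def ex_gt_0_iff ex_gt_Suc_iff image_iff
      Bex_def)

lemma card_column_union:
  assumes "finite B" "finite C"
  shows "card (C \<times> {0} \<union> shift_box ` B) = card C + card B"
proof -
  have "(C \<times> {0}) \<inter> shift_box ` B = {}" by (auto simp: shift_box_def)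
  then show ?thesis
    using assms by (simp add: card_Un_disjoint card_cartesian_product card_image inj_on_subset[OF inj_shift_box])
qed

text \<open>Old boxes keep their type. A box of the rookless new column is a p-box exactly when
  \<phi> has a rook in its row; the k rooks occupy k different rows, all of which meet the new
  column.\<close>

lemma rook_weight_shift:
  assumes "finite B" "fst ` B \<subseteq> {..<n}" "\<phi> \<in> rook_placements B k"
  shows "rook_weight h p q (add_column n B) (shift_box ` \<phi>) =
    p ^ k * q ^ (n - k) * rook_weight h p q B \<phi>"
proof -
  let ?F = "fst ` \<phi>"
  have \<phi>: "finite \<phi>" "card \<phi> = k" "inj_on fst \<phi>" "\<phi> \<subseteq> B"
    using assms(3) by (auto simp: rook_placements_eq)
  have F: "?F \<subseteq> {..<n}" "card ?F = k" "finite ?F"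
    using \<phi> assms(2) by (auto simp: card_image)
  note simps = rook_relations_shift[of "shift_box ` \<phi>" \<phi>, simplified]
  have "p_boxes (add_column n B) (shift_box ` \<phi>) = ?F \<times> {0} \<union> shift_box ` p_boxes B \<phi>"
    using F by (intro box_set_eqI) (auto simp: p_boxes_def simps, auto simp: in_rook_column_def above_rook_def)
  moreover have "q_boxes (add_column n B) (shift_box ` \<phi>) = ({..<n} - ?F) \<times> {0} \<union> shift_box ` q_boxes B \<phi>"
    using F by (intro box_set_eqI) (auto simp: q_boxes_eq simps, auto simp: above_rook_def)
  moreover have "finite (p_boxes B \<phi>)" "finite (q_boxes B \<phi>)"
    using assms(1) by (auto simp: p_boxes_def q_boxes_def)
  ultimately show ?thesis
    using F \<phi> by (simp add: rook_weight_def card_column_union card_Diff_subset power_add card_image inj_on_subset[OF inj_shift_box])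
qed

text \<open>In the rows without a rook of \<phi>, the new rook makes p-boxes above itself and leaves
  q-boxes below. In the other rows a box of the new column is left of a rook and in a rook's column,
  hence cancelled.\<close>

lemma rook_weight_insert:
  assumes "finite B" "fst ` B \<subseteq> {..<n}" "\<phi> \<in> rook_placements B k" and r: "r \<in> {..<n} - fst ` \<phi>"
  shows "rook_weight h p q (add_column n B) (insert (r, 0) (shift_box ` \<phi>)) =
    h * (p ^ card {i \<in> {..<n} - fst ` \<phi>. i < r} * q ^ card {i \<in> {..<n} - fst ` \<phi>. r < i})
      * rook_weight h p q B \<phi>"
proof -
  let ?A = "{..<n} - fst ` \<phi>" and ?\<psi> = "insert (r, 0) (shift_box ` \<phi>)"
  have \<phi>: "finite \<phi>"
    using assms(3) by (auto simp: rook_placements_eq)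
  note simps = rook_relations_shift[of ?\<psi> \<phi>, simplified]
  have col: "above_rook ?\<psi> (i, 0) \<longleftrightarrow> i < r" "in_rook_column ?\<psi> (i, 0)" for i
    by (auto simp: above_rook_def in_rook_column_def)
  have "p_boxes (add_column n B) ?\<psi> = {i \<in> ?A. i < r} \<times> {0} \<union> shift_box ` p_boxes B \<phi>"
    by (intro box_set_eqI) (auto simp: p_boxes_def simps col)
  moreover have "q_boxes (add_column n B) ?\<psi> = {i \<in> ?A. r < i} \<times> {0} \<union> shift_box ` q_boxes B \<phi>"
    using r by (intro box_set_eqI) (auto simp: q_boxes_eq simps col)
  moreover have "finite (p_boxes B \<phi>)" "finite (q_boxes B \<phi>)"
    using assms(1) by (auto simp: p_boxes_def q_boxes_def)
  ultimately show ?thesis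
    using \<phi> by (simp add: rook_weight_def card_column_union power_add card_image inj_on_subset[OF inj_shift_box])
qed

lemma shift_box_placement_iff:
  "shift_box ` \<phi> \<in> rook_placements (add_column n B) k \<longleftrightarrow> \<phi> \<in> rook_placements B k"
proof -
  have "inj_on fst (shift_box ` \<phi>) \<longleftrightarrow> inj_on fst \<phi>" "inj_on snd (shift_box ` \<phi>) \<longleftrightarrow> inj_on snd \<phi>"
    unfolding inj_on_def shift_box_def by auto
  moreover have "shift_box ` \<phi> \<subseteq> add_column n B \<longleftrightarrow> \<phi> \<subseteq> B"
    by (auto simp: shift_box_def)
  moreover have "card (shift_box ` \<phi>) = card \<phi>" "finite (shift_box ` \<phi>) \<longleftrightarrow> finite \<phi>"
    using inj_on_subset[OF inj_shift_box] by (auto simp: card_image finite_image_iff)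
  ultimately show ?thesis by (simp add: rook_placements_eq)
qed

lemma insert_placement_iff:
  "insert (r, 0) (shift_box ` \<phi>) \<in> rook_placements (add_column n B) (Suc k) \<longleftrightarrow>
    \<phi> \<in> rook_placements B k \<and> r \<in> {..<n} - fst ` \<phi>"
proof -
  have "inj_on fst (insert (r, 0) (shift_box ` \<phi>)) \<longleftrightarrow> inj_on fst \<phi> \<and> r \<notin> fst ` \<phi>"
    "inj_on snd (insert (r, 0) (shift_box ` \<phi>)) \<longleftrightarrow> inj_on snd \<phi>"
    unfolding inj_on_def shift_box_def by auto
  moreover have "insert (r, 0) (shift_box ` \<phi>) \<subseteq> add_column n B \<longleftrightarrow> r < n \<and> \<phi> \<subseteq> B"
    by (auto simp: shift_box_def)
  moreover have "finite \<phi> \<Longrightarrow> card (insert (r, 0) (shift_box ` \<phi>)) = Suc (card \<phi>)"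
     "finite (shift_box ` \<phi>) \<longleftrightarrow> finite \<phi>"
    using inj_on_subset[OF inj_shift_box] by (auto simp: card_image finite_image_iff)
  ultimately show ?thesis by (auto simp: rook_placements_eq)
qed

lemma add_column_placement_cases:
  assumes "\<psi> \<in> rook_placements (add_column n B) k"
  obtains \<phi> where "\<psi> = shift_box ` \<phi>" | r \<phi> where "\<psi> = insert (r, 0) (shift_box ` \<phi>)"
proof -
  \<comment> \<open>The rooks outside column 0, moved back by one column.\<close>
  define \<phi> where "\<phi> = {(i, j). (i, Suc j) \<in> \<psi>}"
  show thesis
  proof (cases "\<exists>r. (r, 0) \<in> \<psi>")
    case True
    then obtain r where "(r, 0) \<in> \<psi>" by blast
    moreover have "inj_on snd \<psi>"
      using assms by (simp add: rook_placements_eq)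
    ultimately have "(i, 0) \<in> \<psi> \<longleftrightarrow> i = r" for i
      by (metis inj_onD prod.inject snd_conv)
    then have "\<psi> = insert (r, 0) (shift_box ` \<phi>)"
      by (intro box_set_eqI) (simp_all add: \<phi>_def)
    then show thesis by (rule that(2))
  next
    case False
    then have "\<psi> = shift_box ` \<phi>"
      by (intro box_set_eqI) (auto simp: \<phi>_def)
    then show thesis by (rule that(1))
  qed
qed

lemma shift_box_image_eq_iff: "shift_box ` A = shift_box ` B \<longleftrightarrow> A = B"
  by (simp add: inj_image_eq_iff inj_shift_box)

lemma insert_shift_box_eq_iff:
  "insert (r, 0) (shift_box ` A) = insert (s, 0) (shift_box ` B) \<longleftrightarrow> r = s \<and> A = B"
proof
  assume eq: "insert (r, 0) (shift_box ` A) = insert (s, 0) (shift_box ` B)"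
  then have "(i, j) \<in> insert (r, 0) (shift_box ` A) \<longleftrightarrow> (i, j) \<in> insert (s, 0) (shift_box ` B)" for i j
    by simp
  from this[of _ 0] this[of _ "Suc _"] show "r = s \<and> A = B" by auto
qed simp

section \<open>The recurrence for rook numbers\<close>

lemma rook_number_add_column_0:
  assumes "finite B" "fst ` B \<subseteq> {..<n}"
  shows "rook_number h p q (add_column n B) 0 = q ^ n * rook_number h p q B 0"
proof -
  have "rook_placements C 0 = {{}}" for C
    by (auto simp: rook_placements_eq)
  then show ?thesis
    using rook_weight_shift[OF assms, of "{}" 0] by (simp add: rook_number_def)
qed

lemma rook_number_add_column_Suc:
  assumes B: "finite B" "fst ` B \<subseteq> {..<n}"
  shows "rook_number h p q (add_column n B) (Suc k) =
    p ^ Suc k * q ^ (n - Suc k) * rook_number h p q B (Suc k)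
      + h * twin_basic p q (n - k) * rook_number h p q B k"
proof -
  let ?w = "rook_weight h p q (add_column n B)" and ?P = "rook_placements B"
  let ?N = "(`) shift_box ` ?P (Suc k)"
  \<comment> \<open>A placement with a rook in the new column amounts to a placement of k rooks on
    \<open>B\<close> together with a row free of them.\<close>
  let ?S = "SIGMA \<phi>:?P k. {..<n} - fst ` \<phi>" and ?ins = "\<lambda>(\<phi>, r). insert (r, 0) (shift_box ` \<phi>)"
  have "rook_placements (add_column n B) (Suc k) = ?N \<union> ?ins ` ?S"
  proof (intro equalityI subsetI)
    fix \<psi> assume \<psi>: "\<psi> \<in> rook_placements (add_column n B) (Suc k)"
    from \<psi> show "\<psi> \<in> ?N \<union> ?ins ` ?S"
    proof (cases rule: add_column_placement_cases)
      case (1 \<phi>)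
      with \<psi> show ?thesis by (simp add: shift_box_placement_iff)
    next
      case (2 r \<phi>)
      with \<psi> have "(\<phi>, r) \<in> ?S" by (simp add: insert_placement_iff)
      with 2 show ?thesis by force
    qed
  qed (auto simp: shift_box_placement_iff insert_placement_iff)
  moreover have "?N \<inter> ?ins ` ?S = {}"
  proof -
    have "shift_box ` \<phi> \<noteq> insert (r, 0) (shift_box ` \<phi>')" for r \<phi> \<phi>'
      using shift_box_in_image(2) by (metis insertI1)
    then show ?thesis by auto
  qed
  moreover have fin: "finite (?P m)" for m
    by (rule finite_rook_placements[OF B(1)])
  ultimately have "rook_number h p q (add_column n B) (Suc k) = sum ?w ?N + sum ?w (?ins ` ?S)"
    by (simp add: rook_number_def sum.union_disjoint)
  also have "sum ?w ?N = (\<Sum>\<phi>\<in>?P (Suc k). p ^ Suc k * q ^ (n - Suc k) * rook_weight h p q B \<phi>)"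
    by (subst sum.reindex) (auto simp: inj_on_def shift_box_image_eq_iff rook_weight_shift[OF B])
  also have "\<dots> = p ^ Suc k * q ^ (n - Suc k) * rook_number h p q B (Suc k)"
    by (simp add: rook_number_def sum_distrib_left)
  also have "sum ?w (?ins ` ?S) = (\<Sum>(\<phi>, r)\<in>?S. ?w (insert (r, 0) (shift_box ` \<phi>)))"
    by (subst sum.reindex) (auto simp: inj_on_def insert_shift_box_eq_iff intro!: sum.cong)
  also have "\<dots> = (\<Sum>\<phi>\<in>?P k. \<Sum>r\<in>{..<n} - fst ` \<phi>. ?w (insert (r, 0) (shift_box ` \<phi>)))"
    using fin by (subst sum.Sigma) auto
  also have "\<dots> = (\<Sum>\<phi>\<in>?P k. h * twin_basic p q (n - k) * rook_weight h p q B \<phi>)"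
  proof (rule sum.cong)
    fix \<phi> assume \<phi>: "\<phi> \<in> ?P k"
    let ?A = "{..<n} - fst ` \<phi>"
    have "card ?A = n - k"
      using \<phi> B(2) by (subst card_Diff_subset) (auto simp: rook_placements_eq card_image)
    have "(\<Sum>r\<in>?A. ?w (insert (r, 0) (shift_box ` \<phi>))) =
        (\<Sum>r\<in>?A. h * (p ^ card {i\<in>?A. i < r} * q ^ card {i\<in>?A. r < i}) * rook_weight h p q B \<phi>)"
      by (intro sum.cong refl rook_weight_insert[OF B \<phi>])
    also have "\<dots> = h * twin_basic p q (card ?A) * rook_weight h p q B \<phi>"
      by (subst sum_rank_weights[symmetric]) (simp_all only: sum_distrib_left sum_distrib_right finite_Diff finite_lessThan)
    finally show "(\<Sum>r\<in>?A. ?w (insert (r, 0) (shift_box ` \<phi>))) =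
        h * twin_basic p q (n - k) * rook_weight h p q B \<phi>"
      using \<open>card ?A = n - k\<close> by simp
  qed simp
  also have "\<dots> = h * twin_basic p q (n - k) * rook_number h p q B k"
    by (simp add: rook_number_def sum_distrib_left)
  finally show ?thesis .
qed

text \<open>Both sides obey the same recurrence. The case distinction matters for n = 0, where the
  truncated index n - k is 0 and has Stirling number 1 for every k.\<close>

lemma rook_number_staircase:
  "rook_number h p q (staircase_board n) k = (if k \<le> n then h ^ k * stirling2 p q n (n - k) else 0)"
proof (induction n arbitrary: k)
  case 0
  have "rook_placements {} k = (if k = 0 then {{}} else {})"
    by (auto simp: rook_placements_eq)
  then show ?case
    by (auto simp: rook_number_def staircase_board_eq rook_weight_def p_boxes_def q_boxes_def)
next
  case (Suc n)
  have B: "finite (staircase_board n)" "fst ` staircase_board n \<subseteq> {..<n}"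
    by (auto simp: staircase_board_eq intro: finite_subset[of _ "{..<n} \<times> {..<n}"])
  show ?case
  proof (cases k)
    case 0
    then show ?thesis
      by (simp add: staircase_board_Suc rook_number_add_column_0[OF B] Suc.IH stirling2_eq_0)
  next
    case (Suc k')
    consider "k' < n" | "k' = n" | "n < k'" by linarith
    then show ?thesis
    proof cases
      case 1
      \<comment> \<open>The new Stirling index is \<open>Suc l\<close>, so the last equation of
        \<open>stirling2\<close> applies; its exponents n - l and l are those of the rook
        recurrence.\<close>
      then obtain l where l: "n - k' = Suc l" "n - Suc k' = l" "n - l = Suc k'"
        by (metis Suc_diff_Suc diff_diff_cancel Suc_leI)
      with 1 Suc show ?thesis
        by (simp add: staircase_board_Suc rook_number_add_column_Suc[OF B] Suc.IH algebra_simps)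
    qed (use Suc in \<open>simp_all add: staircase_board_Suc rook_number_add_column_Suc[OF B] Suc.IH\<close>)
  qed
qed

subsection \<open>Normal ordering\<close>

lemma free_ring_simps [simp]:
  "carrier free_ring = UNIV" "x \<otimes>\<^bsub>free_ring\<^esub> y = x * y" "x \<oplus>\<^bsub>free_ring\<^esub> y = x + y"
  "\<one>\<^bsub>free_ring\<^esub> = 1" "\<zero>\<^bsub>free_ring\<^esub> = 0"
  by (simp_all add: ring_of_type_algebra_def)

lemma free_ring_a_inv [simp]: "\<ominus>\<^bsub>free_ring\<^esub> x = - x"
  using ring_free_ring by (intro abelian_group.minus_equality) (simp_all add: ring.is_abelian_group)

lemma weyl_class_add:
  "weyl_class h p q (u + v) = weyl_class h p q u \<oplus>\<^bsub>weyl_algebra h p q\<^esub> weyl_class h p q v"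
  using ring_hom_add[OF weyl_class_hom, of u v h p q] by simp

lemma weyl_class_mult:
  "weyl_class h p q (u * v) = weyl_class h p q u \<otimes>\<^bsub>weyl_algebra h p q\<^esub> weyl_class h p q v"
  using ring_hom_mult[OF weyl_class_hom, of u v h p q] by simp

lemma weyl_class_one: "weyl_class h p q 1 = \<one>\<^bsub>weyl_algebra h p q\<^esub>"
  using ring_hom_one[OF weyl_class_hom, of h p q] by simp

lemma weyl_class_zero: "weyl_class h p q 0 = \<zero>\<^bsub>weyl_algebra h p q\<^esub>"
  using ring_hom_zero[OF weyl_class_hom ring_free_ring ring_weyl_algebra, of h p q] by simp

lemma weyl_class_closed: "weyl_class h p q u \<in> carrier (weyl_algebra h p q)"
  using ring_hom_closed[OF weyl_class_hom, of u h p q] by simp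

lemma weyl_class_power:
  "weyl_class h p q (u ^ n) = weyl_class h p q u [^]\<^bsub>weyl_algebra h p q\<^esub> n"
  by (induction n) (simp_all add: weyl_class_one weyl_class_mult power_Suc2 del: power_Suc)

lemma weyl_class_sum:
  assumes "finite I"
  shows "weyl_class h p q (\<Sum>i\<in>I. f i) = (\<Oplus>\<^bsub>weyl_algebra h p q\<^esub>i\<in>I. weyl_class h p q (f i))"
proof -
  interpret A: ring "weyl_algebra h p q" by (rule ring_weyl_algebra)
  from assms show ?thesis
    by (induction I) (simp_all add: weyl_class_zero weyl_class_add weyl_class_closed)
qed

lemma weyl_class_eq_iff:
  "weyl_class h p q u = weyl_class h p q v \<longleftrightarrow> u - v \<in> weyl_ideal h p q"
proof -
  have "u \<ominus>\<^bsub>free_ring\<^esub> v = u - v" by (simp add: a_minus_def)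
  then show ?thesis
    using ring.quotient_eq_iff_same_a_r_cos[OF ring_free_ring ideal_weyl_ideal, of u v h p q]
    by (simp add: weyl_class_def)
qed

lemma weyl_class_relator:
  "u - v \<in> weyl_relators h p q \<Longrightarrow> weyl_class h p q u = weyl_class h p q v"
  using ring.genideal_self[OF ring_free_ring, of "weyl_relators h p q"]
  by (auto simp: weyl_class_eq_iff weyl_ideal_def)

text \<open>Calculations are done on representatives in the free algebra, a type class ring; the
  congruence rules allow a factor or summand to be replaced by an equivalent one.\<close>

lemma weyl_class_mult_cong:
  "weyl_class h p q u = weyl_class h p q u' \<Longrightarrow> weyl_class h p q v = weyl_class h p q v' \<Longrightarrow>
    weyl_class h p q (u * v) = weyl_class h p q (u' * v')"
  by (simp add: weyl_class_mult)

lemma weyl_class_add_cong: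
  "weyl_class h p q u = weyl_class h p q u' \<Longrightarrow> weyl_class h p q v = weyl_class h p q v' \<Longrightarrow>
    weyl_class h p q (u + v) = weyl_class h p q (u' + v')"
  by (simp add: weyl_class_add)

section \<open>Scalars and powers in the free algebra\<close>

lemma scal_add: "scal (a + b) = scal a + scal b"
  by (simp add: scal_def single_add)

lemma scal_0 [simp]: "scal 0 = 0" and scal_1 [simp]: "scal 1 = 1"
  by (simp_all add: scal_def)

lemma scal_scal: "scal a * scal b = scal (a * b)"
  by (simp add: scal_def mult_single)

lemma scal_scal_left: "scal a * (scal b * u) = scal (a * b) * u"
  by (simp add: scal_scal mult.assoc[symmetric])

text \<open>A scalar is supported on the empty word, hence commutes with every generator.\<close>

lemma gen_scal: "gen g * scal c = scal c * gen g"
  by (simp add: scal_def gen_def mult_single)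

lemma gen_scal_left: "gen g * (scal c * u) = scal c * (gen g * u)"
  by (simp add: gen_scal mult.assoc[symmetric])

lemma gen_power_scal: "gen g ^ n * scal c = scal c * gen g ^ n"
  by (induction n) (simp_all add: gen_scal_left mult.assoc)

lemma gen_power_scal_left: "gen g ^ n * (scal c * u) = scal c * (gen g ^ n * u)"
  by (simp add: gen_power_scal mult.assoc[symmetric])

lemma gen_power_gen_left: "gen g ^ n * (gen g * u) = gen g * (gen g ^ n * u)"
  by (simp add: power_commutes mult.assoc[symmetric])

lemmas free_algebra_simps = mult.assoc scal_scal scal_scal_left gen_scal gen_scal_left
  gen_power_scal gen_power_scal_left power_commutes gen_power_gen_left distrib_left distrib_right

section \<open>Commutation rules and the normal ordered expansion\<close>

lemma weyl_XY: "weyl_class h p q (gen GX * gen GY) =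
    weyl_class h p q (scal q * gen GY * gen GX + scal h * gen GZ)"
  by (rule weyl_class_relator) (simp add: weyl_relators_def diff_diff_eq)

lemma weyl_ZY: "weyl_class h p q (gen GZ * gen GY) = weyl_class h p q (scal p * gen GY * gen GZ)"
  by (rule weyl_class_relator) (simp add: weyl_relators_def)

lemma weyl_XZ: "weyl_class h p q (gen GX * gen GZ) = weyl_class h p q (scal p * gen GZ * gen GX)"
  by (rule weyl_class_relator) (simp add: weyl_relators_def)

lemma weyl_X_Z_power:
  "weyl_class h p q (gen GX * gen GZ ^ b) = weyl_class h p q (scal (p ^ b) * (gen GZ ^ b * gen GX))"
proof (induction b)
  case (Suc b)
  have "weyl_class h p q (gen GX * gen GZ ^ Suc b) = weyl_class h p q ((gen GX * gen GZ) * gen GZ ^ b)"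
    by (simp add: mult.assoc)
  also have "\<dots> = weyl_class h p q ((scal p * gen GZ) * (gen GX * gen GZ ^ b))"
    using weyl_class_mult_cong[OF weyl_XZ refl] by (simp add: mult.assoc)
  also have "\<dots> = weyl_class h p q ((scal p * gen GZ) * (scal (p ^ b) * (gen GZ ^ b * gen GX)))"
    by (rule weyl_class_mult_cong[OF refl Suc.IH])
  finally show ?case by (simp add: free_algebra_simps)
qed simp

text \<open>The leading \<open>Y\<close> avoids the exponent k - 1 and thus a special case for k =
  0. With one more \<open>Y\<close> on the right, passing \<open>X\<close> creates h q^k and passing
  \<open>Z\<close> multiplies by p, so q^k + p [k] = [k+1] gives the new coefficient.\<close>

lemma weyl_YX_Y_power:
  "weyl_class h p q (gen GY * gen GX * gen GY ^ k) =
    weyl_class h p q (scal (q ^ k) * (gen GY ^ Suc k * gen GX)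
      + scal (h * twin_basic p q k) * (gen GY ^ k * gen GZ))"
proof (induction k)
  case (Suc k)
  have "weyl_class h p q (gen GY * gen GX * gen GY ^ Suc k) =
      weyl_class h p q ((gen GY * gen GX * gen GY ^ k) * gen GY)"
    by (simp add: free_algebra_simps)
  also have "\<dots> = weyl_class h p q ((scal (q ^ k) * (gen GY ^ Suc k * gen GX)
      + scal (h * twin_basic p q k) * (gen GY ^ k * gen GZ)) * gen GY)"
    by (rule weyl_class_mult_cong[OF Suc.IH refl])
  \<comment> \<open>Regrouping exposes the products \<open>X Y\<close> and \<open>Z Y\<close> to
    which the relations apply.\<close>
  also have "\<dots> = weyl_class h p q ((scal (q ^ k) * gen GY ^ Suc k) * (gen GX * gen GY)
      + (scal (h * twin_basic p q k) * gen GY ^ k) * (gen GZ * gen GY))"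
    by (simp add: mult.assoc distrib_right)
  also have "\<dots> = weyl_class h p q
      ((scal (q ^ k) * gen GY ^ Suc k) * (scal q * gen GY * gen GX + scal h * gen GZ)
      + (scal (h * twin_basic p q k) * gen GY ^ k) * (scal p * gen GY * gen GZ))"
    by (intro weyl_class_add_cong weyl_class_mult_cong refl weyl_XY weyl_ZY)
  also have "(scal (q ^ k) * gen GY ^ Suc k) * (scal q * gen GY * gen GX + scal h * gen GZ)
      + (scal (h * twin_basic p q k) * gen GY ^ k) * (scal p * gen GY * gen GZ) =
    scal (q ^ Suc k) * (gen GY ^ Suc (Suc k) * gen GX)
      + scal (h * twin_basic p q (Suc k)) * (gen GY ^ Suc k * gen GZ)"
    by (simp add: free_algebra_simps twin_basic_Suc' scal_add mult.commute mult.left_commute add.commute)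
  finally show ?case .
qed simp

text \<open>Equal exponents of \<open>Y\<close> and \<open>X\<close> suffice, since left
  multiplication by \<open>Y X\<close> preserves their difference.\<close>

definition normal_monomial :: "nat \<Rightarrow> nat \<Rightarrow> free_algebra" where
  "normal_monomial k b = gen GY ^ k * gen GZ ^ b * gen GX ^ k"

text \<open>Either \<open>X\<close> passes all of \<open>Y\<close> and \<open>Z\<close> and raises
  k, or it is consumed by a \<open>Y\<close> and raises b. In both terms k + b grows by one, which
  keeps the \<open>Z\<close> exponent equal to n - k.\<close>

lemma weyl_YX_normal_monomial:
  "weyl_class h p q (gen GY * gen GX * normal_monomial k b) =
    weyl_class h p q (scal (q ^ k * p ^ b) * normal_monomial (Suc k) b
      + scal (h * twin_basic p q k) * normal_monomial k (Suc b))"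
proof -
  have "weyl_class h p q (gen GY * gen GX * normal_monomial k b) =
      weyl_class h p q ((gen GY * gen GX * gen GY ^ k) * (gen GZ ^ b * gen GX ^ k))"
    by (simp add: normal_monomial_def mult.assoc)
  also have "\<dots> = weyl_class h p q ((scal (q ^ k) * (gen GY ^ Suc k * gen GX)
      + scal (h * twin_basic p q k) * (gen GY ^ k * gen GZ)) * (gen GZ ^ b * gen GX ^ k))"
    by (rule weyl_class_mult_cong[OF weyl_YX_Y_power refl])
  also have "\<dots> = weyl_class h p q ((scal (q ^ k) * gen GY ^ Suc k) * ((gen GX * gen GZ ^ b) * gen GX ^ k)
      + scal (h * twin_basic p q k) * normal_monomial k (Suc b))"
    by (simp add: normal_monomial_def mult.assoc distrib_right)
  also have "\<dots> = weyl_class h p q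
      ((scal (q ^ k) * gen GY ^ Suc k) * ((scal (p ^ b) * (gen GZ ^ b * gen GX)) * gen GX ^ k)
      + scal (h * twin_basic p q k) * normal_monomial k (Suc b))"
    by (intro weyl_class_add_cong weyl_class_mult_cong refl weyl_X_Z_power)
  finally show ?thesis
    by (simp add: normal_monomial_def free_algebra_simps)
qed

lemma weyl_class_sum_cong:
  assumes "\<And>i. i \<in> I \<Longrightarrow> weyl_class h p q (f i) = weyl_class h p q (g i)"
  shows "weyl_class h p q (sum f I) = weyl_class h p q (sum g I)"
  using assms by (induction I rule: infinite_finite_induct) (simp_all add: weyl_class_add)

lemma weyl_normal_ordering:
  "weyl_class h p q ((gen GY * gen GX) ^ n) =
    weyl_class h p q (\<Sum>k\<le>n. scal (h ^ (n - k) * stirling2 p q n k) * normal_monomial k (n - k))"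
proof (induction n)
  case 0
  then show ?case by (simp add: normal_monomial_def)
next
  case (Suc n)
  let ?c = "\<lambda>k. h ^ (n - k) * stirling2 p q n k"
  \<comment> \<open>The contributions that leave the exponent k unchanged.\<close>
  define g where "g k = scal (h ^ (Suc n - k) * twin_basic p q k * stirling2 p q n k)
    * normal_monomial k (Suc n - k)" for k
  have "weyl_class h p q ((gen GY * gen GX) ^ Suc n) =
      weyl_class h p q (\<Sum>k\<le>n. scal (?c k) * (gen GY * gen GX * normal_monomial k (n - k)))"
    using weyl_class_mult_cong[OF refl Suc.IH, of "gen GY * gen GX"]
    by (simp add: sum_distrib_left free_algebra_simps)
  also have "\<dots> = weyl_class h p q (\<Sum>k\<le>n. scal (?c k) *
      (scal (q ^ k * p ^ (n - k)) * normal_monomial (Suc k) (n - k)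
        + scal (h * twin_basic p q k) * normal_monomial k (Suc (n - k))))"
    by (intro weyl_class_sum_cong weyl_class_mult_cong refl weyl_YX_normal_monomial)
  also have "(\<Sum>k\<le>n. scal (?c k) *
      (scal (q ^ k * p ^ (n - k)) * normal_monomial (Suc k) (n - k)
        + scal (h * twin_basic p q k) * normal_monomial k (Suc (n - k)))) =
    (\<Sum>k\<le>n. scal (?c k * (q ^ k * p ^ (n - k))) * normal_monomial (Suc k) (n - k)) + (\<Sum>k\<le>n. g k)"
    unfolding sum.distrib[symmetric]
    by (intro sum.cong) (simp_all add: g_def distrib_left scal_scal_left Suc_diff_le ac_simps)
  \<comment> \<open>The added term vanishes because S(n, n+1) = 0. The term for k = 0, dropped next,
    vanishes because [0] = 0. Both sums then run over \<open>Suc k\<close> and combine by the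
    Stirling recurrence.\<close>
  also have "(\<Sum>k\<le>n. g k) = (\<Sum>k\<le>Suc n. g k)"
    by (simp add: g_def stirling2_eq_0)
  also have "\<dots> = (\<Sum>k\<le>n. g (Suc k))"
    by (simp add: sum.atMost_Suc_shift g_def del: sum.atMost_Suc)
  also have "(\<Sum>k\<le>n. scal (?c k * (q ^ k * p ^ (n - k))) * normal_monomial (Suc k) (n - k))
      + (\<Sum>k\<le>n. g (Suc k)) =
    (\<Sum>k\<le>n. scal (h ^ (n - k) * stirling2 p q (Suc n) (Suc k)) * normal_monomial (Suc k) (n - k))"
    unfolding sum.distrib[symmetric]
    by (intro sum.cong) (simp_all add: g_def distrib_right[symmetric] scal_add[symmetric] algebra_simps)
  also have "\<dots> = (\<Sum>k\<le>Suc n. scal (h ^ (Suc n - k) * stirling2 p q (Suc n) k) * normal_monomial k (Suc n - k))"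
    by (simp add: sum.atMost_Suc_shift del: sum.atMost_Suc stirling2.simps(4))
  finally show ?case .
qed

subsection \<open>Linear independence of the normally ordered monomials\<close>

text \<open>\<open>f (a, b, c)\<close> is the value of a linear functional at the basis element
  \<open>Y\<^sup>a Z\<^sup>b X\<^sup>c\<close>. Dualizing the left regular representation reverses the order of
  composition but avoids all finiteness conditions.\<close>

type_synonym regular_dual = "nat \<times> nat \<times> nat \<Rightarrow> complex"

text \<open>For \<open>p = 1\<close> the basis consists of the \<open>Y\<^sup>a X\<^sup>c\<close> only, encoded by \<open>b = 0\<close>.\<close>

definition Z_shift :: "complex \<Rightarrow> nat \<Rightarrow> nat" where
  "Z_shift p b = (if p = 1 then b else Suc b)"

text \<open>Read off from X Y^a Z^b X^c = h [a] Y^(a-1) Z^(b+1) X^c + q^a p^b Y^a Z^b X^(c+1) and Z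
  Y^a = p^a Y^a Z. For a = 0 the truncated a - 1 is harmless as [0] = 0.\<close>

fun gen_transpose :: "complex \<Rightarrow> complex \<Rightarrow> complex \<Rightarrow> generator \<Rightarrow> regular_dual \<Rightarrow> regular_dual" where
  "gen_transpose h p q GX f (a, b, c) =
     h * twin_basic p q a * f (a - 1, Z_shift p b, c) + q ^ a * p ^ b * f (a, b, Suc c)"
| "gen_transpose h p q GY f (a, b, c) = f (Suc a, b, c)"
| "gen_transpose h p q GZ f (a, b, c) = p ^ a * f (a, Z_shift p b, c)"

text \<open>\<open>fold\<close> lets the first letter act first, the order that transposition
  requires.\<close>

definition word_transpose :: "complex \<Rightarrow> complex \<Rightarrow> complex \<Rightarrow> word \<Rightarrow> regular_dual \<Rightarrow> regular_dual" where
  "word_transpose h p q w = fold (gen_transpose h p q) (letters w)"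

definition algebra_transpose :: "complex \<Rightarrow> complex \<Rightarrow> complex \<Rightarrow> free_algebra \<Rightarrow> regular_dual \<Rightarrow> regular_dual" where
  "algebra_transpose h p q u f x =
     (\<Sum>w\<in>Poly_Mapping.keys u. Poly_Mapping.lookup u w * word_transpose h p q w f x)"

text \<open>One statement on linear combinations yields additivity, homogeneity and, with both
  coefficients 0, the value at the zero function.\<close>

lemma gen_transpose_linear:
  "gen_transpose h p q g (\<lambda>x. \<alpha> * f x + \<beta> * f' x) =
    (\<lambda>x. \<alpha> * gen_transpose h p q g f x + \<beta> * gen_transpose h p q g f' x)"
proof
  fix x :: "nat \<times> nat \<times> nat"
  obtain a b c where "x = (a, b, c)" by (metis prod_cases3)
  then show "gen_transpose h p q g (\<lambda>x. \<alpha> * f x + \<beta> * f' x) x =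
    \<alpha> * gen_transpose h p q g f x + \<beta> * gen_transpose h p q g f' x"
    by (cases g) (simp_all add: algebra_simps)
qed

lemma word_transpose_linear:
  "word_transpose h p q w (\<lambda>x. \<alpha> * f x + \<beta> * f' x) =
    (\<lambda>x. \<alpha> * word_transpose h p q w f x + \<beta> * word_transpose h p q w f' x)"
proof -
  have "fold (gen_transpose h p q) ws (\<lambda>x. \<alpha> * f x + \<beta> * f' x) =
    (\<lambda>x. \<alpha> * fold (gen_transpose h p q) ws f x + \<beta> * fold (gen_transpose h p q) ws f' x)" for ws
    by (induction ws arbitrary: f f') (simp_all add: gen_transpose_linear)
  then show ?thesis by (simp add: word_transpose_def)
qed

lemma transpose_linear:
  "algebra_transpose h p q u (\<lambda>x. \<alpha> * f x + \<beta> * f' x) =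
    (\<lambda>x. \<alpha> * algebra_transpose h p q u f x + \<beta> * algebra_transpose h p q u f' x)"
  by (rule ext) (simp add: algebra_transpose_def word_transpose_linear sum.distrib sum_distrib_left algebra_simps)

section \<open>The action of the whole free algebra\<close>

lemma transpose_superset:
  assumes "finite W" "Poly_Mapping.keys u \<subseteq> W"
  shows "algebra_transpose h p q u f x = (\<Sum>w\<in>W. Poly_Mapping.lookup u w * word_transpose h p q w f x)"
  unfolding algebra_transpose_def using assms
  by (intro sum.mono_neutral_left) (auto simp: in_keys_iff)

lemma transpose_add: "algebra_transpose h p q (u + v) f = (\<lambda>x. algebra_transpose h p q u f x + algebra_transpose h p q v f x)"
proof
  fix x
  let ?W = "Poly_Mapping.keys u \<union> Poly_Mapping.keys v"
  have "Poly_Mapping.keys (u + v) \<subseteq> ?W" by (rule keys_add)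
  then show "algebra_transpose h p q (u + v) f x = algebra_transpose h p q u f x + algebra_transpose h p q v f x"
    by (simp add: transpose_superset[of ?W] lookup_add distrib_right sum.distrib)
qed

lemma transpose_uminus: "algebra_transpose h p q (- u) f = (\<lambda>x. - algebra_transpose h p q u f x)"
  by (rule ext) (simp add: transpose_superset[of "Poly_Mapping.keys u"] keys.rep_eq sum_negf)

lemma transpose_diff: "algebra_transpose h p q (u - v) f = (\<lambda>x. algebra_transpose h p q u f x - algebra_transpose h p q v f x)"
  using transpose_add[of h p q u "- v" f] by (simp add: transpose_uminus)

lemma transpose_zero [simp]: "algebra_transpose h p q 0 f = (\<lambda>x. 0)"
  by (rule ext) (simp add: algebra_transpose_def)

lemma transpose_single:
  "algebra_transpose h p q (Poly_Mapping.single w c) f = (\<lambda>x. c * word_transpose h p q w f x)"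
  by (rule ext) (simp add: transpose_superset[of "{w}"])

lemma poly_mapping_single_induct [case_names zero single_add]:
  fixes u :: "'a \<Rightarrow>\<^sub>0 'b::monoid_add"
  assumes "P 0" "\<And>w c u. P u \<Longrightarrow> P (Poly_Mapping.single w c + u)"
  shows "P u"
proof (induction u rule: update_induct)
  case const
  then show ?case using assms(1) by simp
next
  case (update u w c)
  then have "Poly_Mapping.update w c u = Poly_Mapping.single w c + u"
    by (intro poly_mapping_eqI) (auto simp: lookup_add lookup_update lookup_single in_keys_iff when_def)
  with update assms(2) show ?case by simp
qed

lemma word_transpose_add: "word_transpose h p q (v + w) f = word_transpose h p q w (word_transpose h p q v f)"
  by (simp add: word_transpose_def plus_word_def)

text \<open>Two nested inductions reduce the claim to single words, where concatenation becomes
  composition in reverse order.\<close>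

lemma transpose_mult: "algebra_transpose h p q (u * v) f = algebra_transpose h p q v (algebra_transpose h p q u f)"
proof (induction u rule: poly_mapping_single_induct)
  case zero
  then show ?case using transpose_linear[of h p q v 0 "\<lambda>x. 0" 0 "\<lambda>x. 0"] by simp
next
  case (single_add w c u)
  have "algebra_transpose h p q (Poly_Mapping.single w c * v) f = algebra_transpose h p q v (algebra_transpose h p q (Poly_Mapping.single w c) f)"
  proof (induction v rule: poly_mapping_single_induct)
    case (single_add w' c' v)
    then show ?case
      using word_transpose_linear[of h p q w' c "word_transpose h p q w f" 0]
      by (simp add: distrib_left transpose_add mult_single transpose_single word_transpose_add algebra_simps)
  qed simp
  then show ?case
    using single_add transpose_linear[of h p q v 1 "algebra_transpose h p q (Poly_Mapping.single w c) f" 1 "algebra_transpose h p q u f"]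
    by (simp add: distrib_right transpose_add)
qed

lemma transpose_gen [simp]: "algebra_transpose h p q (gen g) = gen_transpose h p q g"
  by (intro ext) (simp add: gen_def transpose_single word_transpose_def)

lemma transpose_scal [simp]: "algebra_transpose h p q (scal c) f = (\<lambda>x. c * f x)"
  by (simp add: scal_def transpose_single word_transpose_def zero_word_def)

lemma transpose_one [simp]: "algebra_transpose h p q 1 f = f"
  using transpose_scal[of h p q 1 f] by simp

text \<open>The \<open>XY\<close> relation amounts to [a+1] = p^a + q [a], the other two to
  comparing powers of p. For p = 1 the generator \<open>Z\<close> acts as the identity.\<close>

lemma transpose_relator:
  assumes "u \<in> weyl_relators h p q"
  shows "algebra_transpose h p q u f = (\<lambda>x. 0)"
proof
  fix x :: "nat \<times> nat \<times> nat"
  obtain a b c where x: "x = (a, b, c)" by (metis prod_cases3)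
  \<comment> \<open>For p = 1 the exponent stays, but both sides equal 1.\<close>
  have p: "p ^ Z_shift p b = p * p ^ b" by (simp add: Z_shift_def)
  consider "u = gen GX * gen GY - scal q * gen GY * gen GX - scal h * gen GZ"
    | "u = gen GZ * gen GY - scal p * gen GY * gen GZ"
    | "u = gen GX * gen GZ - scal p * gen GZ * gen GX"
    | "u = gen GZ - 1" "p = 1"
    using assms by (auto simp: weyl_relators_def split: if_splits)
  then show "algebra_transpose h p q u f x = 0"
  proof cases
    case 1
    show ?thesis
      unfolding 1
      by (cases a) (simp_all add: x transpose_diff transpose_add transpose_mult twin_basic_Suc algebra_simps)
  next
    case 2
    show ?thesis
      unfolding 2 by (simp add: x transpose_diff transpose_mult)
  next
    case 3
    show ?thesis
      unfolding 3
      by (cases a) (simp_all add: x p transpose_diff transpose_mult algebra_simps)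
  next
    case 4
    then show ?thesis
      by (simp add: x transpose_diff Z_shift_def)
  qed
qed

lemma ideal_transpose_kernel: "ideal {u. \<forall>f. algebra_transpose h p q u f = (\<lambda>x. 0)} free_ring"
proof (rule idealI[OF ring_free_ring])
  show "subgroup {u. \<forall>f. algebra_transpose h p q u f = (\<lambda>x. 0)} (add_monoid free_ring)"
  proof (rule group.subgroupI)
    show "group (add_monoid free_ring)"
      using ring_free_ring by (meson abelian_group.a_group ring.is_abelian_group)
    show "{u. \<forall>f. algebra_transpose h p q u f = (\<lambda>x. 0)} \<noteq> {}"
      using transpose_zero by blast
    fix u :: free_algebra
    assume "u \<in> {u. \<forall>f. algebra_transpose h p q u f = (\<lambda>x. 0)}"
    then show "inv\<^bsub>add_monoid free_ring\<^esub> u \<in> {u. \<forall>f. algebra_transpose h p q u f = (\<lambda>x. 0)}"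
      unfolding free_ring_a_inv[unfolded a_inv_def] by (simp add: transpose_uminus)
  qed (simp_all add: transpose_add)
next
  fix u v :: free_algebra
  assume u: "u \<in> {u. \<forall>f. algebra_transpose h p q u f = (\<lambda>x. 0)}"
  then show "v \<otimes>\<^bsub>free_ring\<^esub> u \<in> {u. \<forall>f. algebra_transpose h p q u f = (\<lambda>x. 0)}"
    by (simp add: transpose_mult)
  show "u \<otimes>\<^bsub>free_ring\<^esub> v \<in> {u. \<forall>f. algebra_transpose h p q u f = (\<lambda>x. 0)}"
    using u transpose_linear[of h p q v 0 "\<lambda>x. 0" 0 "\<lambda>x. 0"] by (simp add: transpose_mult)
qed

text \<open>The kernel of the action is a two-sided ideal containing the relators, hence contains
  the ideal they generate.\<close>

lemma transpose_weyl_ideal: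
  assumes "u \<in> weyl_ideal h p q"
  shows "algebra_transpose h p q u f = (\<lambda>x. 0)"
proof -
  have "weyl_ideal h p q \<subseteq> {u. \<forall>f. algebra_transpose h p q u f = (\<lambda>x. 0)}"
    unfolding weyl_ideal_def
    by (rule ring.genideal_minimal[OF ring_free_ring ideal_transpose_kernel])
      (auto simp: transpose_relator)
  with assms show ?thesis by auto
qed

section \<open>Evaluation at the basis element 1 and uniqueness\<close>

lemma transpose_Y_power: "algebra_transpose h p q (gen GY ^ k) f (a, b, c) = f (a + k, b, c)"
  by (induction k arbitrary: f) (simp_all add: transpose_mult)

text \<open>At a = b = 0 the term that lowers a has coefficient [0] = 0 and the other coefficient is
  1.\<close>

lemma transpose_X_power: "algebra_transpose h p q (gen GX ^ k) f (0, 0, c) = f (0, 0, c + k)"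
  by (induction k arbitrary: f) (simp_all add: transpose_mult)

lemma transpose_Z_power: "algebra_transpose h p q (gen GZ ^ k) f (0, b, c) = f (0, (Z_shift p ^^ k) b, c)"
  by (induction k arbitrary: f) (simp_all add: transpose_mult)

lemma transpose_normal_monomial:
  "algebra_transpose h p q (normal_monomial k b) f (0, 0, 0) = f (k, (Z_shift p ^^ b) 0, k)"
  by (simp add: normal_monomial_def transpose_mult transpose_X_power transpose_Z_power transpose_Y_power)

lemma transpose_sum: "algebra_transpose h p q (\<Sum>i\<in>I. g i) f x = (\<Sum>i\<in>I. algebra_transpose h p q (g i) f x)"
  by (induction I rule: infinite_finite_induct) (simp_all add: transpose_add)

lemma normal_form_unique:
  assumes "weyl_class h p q (\<Sum>k\<le>n. scal (c k) * normal_monomial k (n - k)) =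
      weyl_class h p q (\<Sum>k\<le>n. scal (d k) * normal_monomial k (n - k))"
    and "l \<le> n"
  shows "c l = d l"
proof -
  \<comment> \<open>Within the sum the \<open>Y\<close> exponent alone identifies the monomial, so
    this functional extracts the coefficient with index l whether or not p = 1.\<close>
  let ?f = "\<lambda>(a, b, c). if a = l then 1 else 0 :: complex"
  let ?u = "\<lambda>c. \<Sum>k\<le>n. scal (c k) * normal_monomial k (n - k)"
  have scal_mult: "algebra_transpose h p q (scal a * v) f x = a * algebra_transpose h p q v f x" for a v f x
    using transpose_linear[of h p q v a f 0] by (simp add: transpose_mult)
  have "algebra_transpose h p q (?u c) ?f (0, 0, 0) = c l" for c
    using assms(2) by (simp add: transpose_sum scal_mult transpose_normal_monomial if_distrib cong: if_cong)
  moreover have "algebra_transpose h p q (?u c - ?u d) ?f (0, 0, 0) = 0"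
    using assms(1) by (simp add: weyl_class_eq_iff transpose_weyl_ideal)
  ultimately show ?thesis by (simp add: transpose_diff)
qed

lemma weyl_class_normal_form:
  fixes h p q :: complex
  defines "A \<equiv> weyl_algebra h p q" and "x \<equiv> weyl_X h p q" and "y \<equiv> weyl_Y h p q" and "z \<equiv> weyl_Z h p q"
  shows "(\<Oplus>\<^bsub>A\<^esub>k\<in>{0..n}. weyl_scal h p q (c k) \<otimes>\<^bsub>A\<^esub>
      (y [^]\<^bsub>A\<^esub> k \<otimes>\<^bsub>A\<^esub> z [^]\<^bsub>A\<^esub> (n - k) \<otimes>\<^bsub>A\<^esub> x [^]\<^bsub>A\<^esub> k)) =
    weyl_class h p q (\<Sum>k\<le>n. scal (c k) * normal_monomial k (n - k))"
  by (simp add: assms weyl_class_sum weyl_class_mult weyl_class_power normal_monomial_def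
      weyl_X_def weyl_Y_def weyl_Z_def weyl_scal_def atLeast0AtMost)

lemma normal_ordering_coeff_eq:
  assumes "l \<le> n"
    and "weyl_class h p q ((gen GY * gen GX) ^ n) =
      weyl_class h p q (\<Sum>k\<le>n. scal (d k) * normal_monomial k (n - k))"
  shows "normal_ordering_coeff h p q n l = d l"
proof -
  \<comment> \<open>Cut off above n, as the definite description demands; d itself is arbitrary
    there.\<close>
  let ?d = "\<lambda>k. if k \<le> n then d k else 0"
  have "normal_ordering_coeff h p q n = (THE c. (\<forall>k>n. c k = 0) \<and>
      weyl_class h p q ((gen GY * gen GX) ^ n) =
      weyl_class h p q (\<Sum>k\<le>n. scal (c k) * normal_monomial k (n - k)))"
    unfolding normal_ordering_coeff_def Let_def weyl_class_normal_form
    by (simp add: weyl_class_power weyl_class_mult weyl_X_def weyl_Y_def)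
  also have "\<dots> = ?d"
  proof (rule the_equality)
    show "(\<forall>k>n. ?d k = 0) \<and> weyl_class h p q ((gen GY * gen GX) ^ n) =
        weyl_class h p q (\<Sum>k\<le>n. scal (?d k) * normal_monomial k (n - k))"
      using assms(2) by simp
  next
    fix c
    assume c: "(\<forall>k>n. c k = 0) \<and> weyl_class h p q ((gen GY * gen GX) ^ n) =
        weyl_class h p q (\<Sum>k\<le>n. scal (c k) * normal_monomial k (n - k))"
    then have "c k = d k" if "k \<le> n" for k
      using assms(2) that by (intro normal_form_unique[of h p q c n d]) simp_all
    with c show "c = ?d" by auto
  qed
  finally show ?thesis using assms(1) by simp
qed

theorem corollary4p5:
  fixes h p q :: complex and n :: nat
  assumes "h \<noteq> 0" and "n \<ge> 1"
  shows "(let A = weyl_algebra h p q; x = weyl_X h p q; y = weyl_Y h p q; z = weyl_Z h p q in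
           (y \<otimes>\<^bsub>A\<^esub> x) [^]\<^bsub>A\<^esub> n =
           (\<Oplus>\<^bsub>A\<^esub>l\<in>{0..n}. weyl_scal h p q (rook_number h p q (staircase_board n) (n - l)) \<otimes>\<^bsub>A\<^esub>
              (y [^]\<^bsub>A\<^esub> l \<otimes>\<^bsub>A\<^esub> z [^]\<^bsub>A\<^esub> (n - l) \<otimes>\<^bsub>A\<^esub> x [^]\<^bsub>A\<^esub> l)))
    \<and> (\<forall>l\<le>n. normal_ordering_coeff h p q n l = rook_number h p q (staircase_board n) (n - l))
    \<and> (\<forall>l\<le>n. stirling2 p q n l = rook_number 1 p q (staircase_board n) (n - l))"
proof -
  let ?r = "\<lambda>l. rook_number h p q (staircase_board n) (n - l)"
  have ordering: "weyl_class h p q ((gen GY * gen GX) ^ n) =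
      weyl_class h p q (\<Sum>k\<le>n. scal (?r k) * normal_monomial k (n - k))"
    by (simp add: weyl_normal_ordering rook_number_staircase)
  show ?thesis
    unfolding Let_def weyl_class_normal_form
    \<comment> \<open>The last claim is \<open>rook_number_staircase\<close> at h = 1, where the
      power of h disappears and n - (n - l) = l.\<close>
    using ordering normal_ordering_coeff_eq[OF _ ordering]
    by (simp add: weyl_class_power weyl_class_mult weyl_X_def weyl_Y_def rook_number_staircase)
qed

end
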